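(* Let $N$ be a timelike ruled surface of type $N_-$ in $\mathbb{R}_1^3$ with timelike striction curve $\vec c$ and curvatures $k_1,k_2$, and let $N^\beta$ be a $\beta$-transversal surface of $N$ whose striction curve $\vec c_\beta$ coincides with $\vec c$. Then $\vec c$ is a geodesic on $N$ if and only if there exists a constant $y\in\mathbb{R}$ such that $k_1=y(\beta'+k_2)$ on $I$.
   Context: $\mathbb{R}_1^3$ is Minkowski 3-space with metric $\langle\cdot,\cdot\rangle=-dx_1^2+dx_2^2+dx_3^2$. A nonzero vector $\vec v$ is timelike if $\langle\vec v,\vec v\rangle<0$, null if $\langle\vec v,\vec v\rangle=0$, spacelike if $\langle\vec v,\vec v\rangle>0$. Setting. All functions are smooth on an open interval $I$. A timelike ruled surface of type $N_-$ with timelike striction curve is $\vec r(s,v)=\vec c(s)+v\vec q(s)$, with ruling direction $\vec q$ unit timelike, where $\vec c$ is its striction curve, a timelike curve parametrized by arc length $s$. It has a Frenet frame $\{\vec q,\vec h,\vec a\}$ of mutually orthogonal vectors, $\langle\vec q,\vec q\rangle=-1$, $\langle\vec h,\vec h\rangle=\langle\vec a,\vec a\rangle=1$ ($\vec h$ is the central normal, i.e. the surface normal along $\vec c$; $\vec a$ the central tangent), with $\vec q\,'=k_1\vec h$, $\vec h'=k_1\vec q+k_2\vec a$, $\vec a'=-k_2\vec h$ (prime is $d/ds$) for functions $k_1,k_2$. Standing assumption: the derivatives of the frame vectors are non-null and $N$ is non-cylindrical; in particular $k_1\neq0$ and $k_1^2\neq k_2^2$ everywhere. The unit tangent of $\vec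 c$ is $\vec c\,'=\vec t=\cosh\theta\,\vec q+\sinh\theta\,\vec a$ for a real function $\theta$ (the hyperbolic angle between $\vec t$ and $\vec q$). $\beta$-transversal surface. For a function $\beta:I\to\mathbb{R}$ with $\beta(s)\neq n\pi,\ (2n+1)\pi/2$ for all $s\in I$, $n\in\mathbb{Z}$, $N^\beta$ is the ruled surface $\vec r_\beta(s,v)=\vec c(s)+v\vec q_\beta(s)$ with $\vec q_\beta=\cos\beta\,\vec h+\sin\beta\,\vec a$; it is assumed that $\langle\vec q_\beta',\vec q_\beta'\rangle\ne0$ everywhere. Its striction curve is $\vec c_\beta=\vec c+v_\beta\vec q_\beta$ with $v_\beta=-\langle\vec c\,',\vec q_\beta'\rangle/\langle\vec q_\beta',\vec q_\beta'\rangle$; it coincides with $\vec c$ if $v_\beta=0$ on $I$. The curve $\vec c$ is a geodesic on $N$ if $\vec h$ and $\vec c\,''$ are linearly dependent at every $s\in I$. *)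

theory Defs
  imports "HOL-Analysis.Analysis"
begin

definition minkowski :: "real ^ 3 \<Rightarrow> real ^ 3 \<Rightarrow> real" where
  "minkowski x y = - (x $ 1 * y $ 1) + x $ 2 * y $ 2 + x $ 3 * y $ 3"

definition timelike :: "real ^ 3 \<Rightarrow> bool" where
  "timelike v \<longleftrightarrow> v \<noteq> 0 \<and> minkowski v v < 0"

text \<open>The zero vector is not null: causal characters are attributed to nonzero vectors only.\<close>

definition null_vec :: "real ^ 3 \<Rightarrow> bool" where
  "null_vec v \<longleftrightarrow> v \<noteq> 0 \<and> minkowski v v = 0"

abbreviation vderiv :: "(real \<Rightarrow> 'a::real_normed_vector) \<Rightarrow> real \<Rightarrow> 'a" where
  "vderiv f \<equiv> (\<lambda>s. vector_derivative f (at s))"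

text \<open>Meant for open \<open>I\<close>, where the values of the iterated derivatives outside \<open>I\<close>
  play no role.\<close>

definition smooth_curve_on :: "real set \<Rightarrow> (real \<Rightarrow> 'a::real_normed_vector) \<Rightarrow> bool" where
  "smooth_curve_on I f \<longleftrightarrow> (\<forall>n. \<forall>s\<in>I. (vderiv ^^ n) f differentiable (at s))"

definition ruled_surface :: "(real \<Rightarrow> real ^ 3) \<Rightarrow> (real \<Rightarrow> real ^ 3) \<Rightarrow> real \<Rightarrow> real \<Rightarrow> real ^ 3" where
  "ruled_surface c q s v = c s + v *\<^sub>R q s"

definition normal_to_surface_at ::
    "(real \<Rightarrow> real \<Rightarrow> real ^ 3) \<Rightarrow> real \<Rightarrow> real \<Rightarrow> real ^ 3 \<Rightarrow> bool" where
  "normal_to_surface_at r s v n \<longleftrightarrow>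
     minkowski (vderiv (\<lambda>u. r u v) s) n = 0 \<and> minkowski (vderiv (\<lambda>w. r s w) v) n = 0"

text \<open>Only meaningful where the derivative of the ruling direction has nonzero Minkowski square.\<close>

definition striction_param :: "(real \<Rightarrow> real ^ 3) \<Rightarrow> (real \<Rightarrow> real ^ 3) \<Rightarrow> real \<Rightarrow> real" where
  "striction_param c q s =
     - minkowski (vderiv c s) (vderiv q s) / minkowski (vderiv q s) (vderiv q s)"

definition striction_curve :: "(real \<Rightarrow> real ^ 3) \<Rightarrow> (real \<Rightarrow> real ^ 3) \<Rightarrow> real \<Rightarrow> real ^ 3" where
  "striction_curve c q s = ruled_surface c q s (striction_param c q s)"

definition non_cylindrical_on :: "real set \<Rightarrow> (real \<Rightarrow> real ^ 3) \<Rightarrow> bool" where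
  "non_cylindrical_on I q \<longleftrightarrow> (\<forall>s\<in>I. vderiv q s \<noteq> 0)"

text \<open>\<open>q\<close>: ruling, \<open>h\<close>: central normal, \<open>a\<close>: central tangent.\<close>

definition Nminus_frame ::
    "real set \<Rightarrow> (real \<Rightarrow> real ^ 3) \<Rightarrow> (real \<Rightarrow> real ^ 3) \<Rightarrow> (real \<Rightarrow> real ^ 3)
     \<Rightarrow> (real \<Rightarrow> real) \<Rightarrow> (real \<Rightarrow> real) \<Rightarrow> bool" where
  "Nminus_frame I q h a k1 k2 \<longleftrightarrow>
     smooth_curve_on I q \<and> smooth_curve_on I h \<and> smooth_curve_on I a \<and>
     smooth_curve_on I k1 \<and> smooth_curve_on I k2 \<and>
     (\<forall>s\<in>I.
        minkowski (q s) (q s) = -1 \<and> minkowski (h s) (h s) = 1 \<and> minkowski (a s) (a s) = 1 \<and>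
        minkowski (q s) (h s) = 0 \<and> minkowski (q s) (a s) = 0 \<and> minkowski (h s) (a s) = 0 \<and>
        vderiv q s = k1 s *\<^sub>R h s \<and>
        vderiv h s = k1 s *\<^sub>R q s + k2 s *\<^sub>R a s \<and>
        vderiv a s = - k2 s *\<^sub>R h s \<and>
        \<not> null_vec (vderiv q s) \<and> \<not> null_vec (vderiv h s) \<and> \<not> null_vec (vderiv a s))"

text \<open>A timelike ruled surface of type \<open>N\<^sub>-\<close> with timelike striction curve \<open>c\<close>, arc length
  parameter on the interval \<open>I\<close>, Frenet frame \<open>q, h, a\<close>, curvatures \<open>k1, k2\<close>, and hyperbolic
  angle \<open>\<theta>\<close> between the tangent of \<open>c\<close> and the ruling. The clauses saying that \<open>c\<close> is a unit speed
  timelike curve, that it is its own striction curve and that \<open>h\<close> is normal to the surface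
  along it also follow from the remaining ones.\<close>

definition timelike_ruled_surface_Nminus ::
    "real set \<Rightarrow> (real \<Rightarrow> real ^ 3) \<Rightarrow> (real \<Rightarrow> real ^ 3) \<Rightarrow> (real \<Rightarrow> real ^ 3) \<Rightarrow> (real \<Rightarrow> real ^ 3)
     \<Rightarrow> (real \<Rightarrow> real) \<Rightarrow> (real \<Rightarrow> real) \<Rightarrow> (real \<Rightarrow> real) \<Rightarrow> bool" where
  "timelike_ruled_surface_Nminus I c q h a k1 k2 \<theta> \<longleftrightarrow>
     Nminus_frame I q h a k1 k2 \<and> non_cylindrical_on I q \<and>
     smooth_curve_on I c \<and> smooth_curve_on I \<theta> \<and>
     (\<forall>s\<in>I.
        timelike (vderiv c s) \<and> minkowski (vderiv c s) (vderiv c s) = -1 \<and>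
        vderiv c s = cosh (\<theta> s) *\<^sub>R q s + sinh (\<theta> s) *\<^sub>R a s \<and>
        striction_curve c q s = c s \<and>
        normal_to_surface_at (ruled_surface c q) s 0 (h s))"

definition transversal_ruling ::
    "(real \<Rightarrow> real) \<Rightarrow> (real \<Rightarrow> real ^ 3) \<Rightarrow> (real \<Rightarrow> real ^ 3) \<Rightarrow> real \<Rightarrow> real ^ 3" where
  "transversal_ruling \<beta> h a s = cos (\<beta> s) *\<^sub>R h s + sin (\<beta> s) *\<^sub>R a s"

text \<open>The conditions on \<open>\<beta>\<close> under which \<open>ruled_surface c (transversal_ruling \<beta> h a)\<close> is a
  \<open>\<beta>\<close>-transversal surface of the ruled surface with frame \<open>q, h, a\<close>.\<close>

definition transversal_surface ::
    "real set \<Rightarrow> (real \<Rightarrow> real) \<Rightarrow> (real \<Rightarrow> real ^ 3) \<Rightarrow> (real \<Rightarrow> real ^ 3) \<Rightarrow> bool" where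
  "transversal_surface I \<beta> h a \<longleftrightarrow>
     smooth_curve_on I \<beta> \<and>
     (\<forall>s\<in>I. \<forall>n::int. \<beta> s \<noteq> of_int n * pi \<and> \<beta> s \<noteq> (2 * of_int n + 1) * pi / 2) \<and>
     (\<forall>s\<in>I. minkowski (vderiv (transversal_ruling \<beta> h a) s)
                       (vderiv (transversal_ruling \<beta> h a) s) \<noteq> 0)"

text \<open>Linear dependence of a pair (a family, not the set \<open>{x, y}\<close>, which may be a singleton).\<close>

definition lin_dep_pair :: "real ^ 3 \<Rightarrow> real ^ 3 \<Rightarrow> bool" where
  "lin_dep_pair x y \<longleftrightarrow> (\<exists>u w. (u \<noteq> 0 \<or> w \<noteq> 0) \<and> u *\<^sub>R x + w *\<^sub>R y = 0)"

definition geodesic_on_ruled_surface ::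
    "real set \<Rightarrow> (real \<Rightarrow> real ^ 3) \<Rightarrow> (real \<Rightarrow> real ^ 3) \<Rightarrow> bool" where
  "geodesic_on_ruled_surface I c h \<longleftrightarrow> (\<forall>s\<in>I. lin_dep_pair (h s) (vderiv (vderiv c) s))"

end

theory Submission
  imports Defs
begin

text \<open>Differentiating in the frame shows that \<open>\<langle>c', q\<^sub>\<beta>'\<rangle> = cos \<beta> (sinh \<theta> (\<beta>' + k\<^sub>2) - cosh \<theta> k\<^sub>1)\<close>, so the
  striction curves coincide exactly when \<open>k\<^sub>1 = tanh \<theta> (\<beta>' + k\<^sub>2)\<close>. The component of \<open>c''\<close> orthogonal
  to \<open>h\<close> is \<open>\<theta>' (sinh \<theta> q + cosh \<theta> a)\<close>, so \<open>c\<close> is a geodesic exactly when \<open>\<theta>\<close> is constant, with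
  \<open>y = tanh \<theta>\<close>.\<close>

lemma minkowski_add_left: "minkowski (x + y) z = minkowski x z + minkowski y z"
  by (simp add: minkowski_def algebra_simps)

lemma minkowski_add_right: "minkowski z (x + y) = minkowski z x + minkowski z y"
  by (simp add: minkowski_def algebra_simps)

lemma minkowski_diff_right: "minkowski z (x - y) = minkowski z x - minkowski z y"
  by (simp add: minkowski_def algebra_simps)

lemma minkowski_scaleR_left: "minkowski (r *\<^sub>R x) y = r * minkowski x y"
  by (simp add: minkowski_def algebra_simps)

lemma minkowski_scaleR_right: "minkowski x (r *\<^sub>R y) = r * minkowski x y"
  by (simp add: minkowski_def algebra_simps)

lemma minkowski_zero_left: "minkowski 0 x = 0"
  by (simp add: minkowski_def)

lemma minkowski_commute: "minkowski x y = minkowski y x"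
  by (simp add: minkowski_def mult.commute)

lemmas minkowski_bilinear =
  minkowski_add_left minkowski_add_right minkowski_scaleR_left minkowski_scaleR_right

lemma smooth_curve_on_has_vector_derivative:
  assumes "smooth_curve_on I f" "s \<in> I"
  shows "(f has_vector_derivative vderiv f s) (at s)"
proof -
  have "(vderiv ^^ 0) f differentiable (at s)"
    using assms unfolding smooth_curve_on_def by blast
  then show ?thesis by (simp add: vector_derivative_works)
qed

lemma smooth_curve_on_has_real_derivative:
  fixes f :: "real \<Rightarrow> real"
  assumes "smooth_curve_on I f" "s \<in> I"
  shows "(f has_real_derivative deriv f s) (at s)"
proof -
  have "(f has_real_derivative vderiv f s) (at s)"
    using smooth_curve_on_has_vector_derivative[OF assms]
    by (simp add: has_real_derivative_iff_has_vector_derivative)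
  then show ?thesis by (metis DERIV_imp_deriv)
qed

lemma Nminus_frame_orthonormal:
  assumes "Nminus_frame I q h a k1 k2" "s \<in> I"
  shows "minkowski (q s) (q s) = -1" "minkowski (h s) (h s) = 1" "minkowski (a s) (a s) = 1"
    "minkowski (q s) (h s) = 0" "minkowski (q s) (a s) = 0" "minkowski (h s) (a s) = 0"
    "minkowski (h s) (q s) = 0" "minkowski (a s) (q s) = 0" "minkowski (a s) (h s) = 0"
  using assms by (auto simp: Nminus_frame_def minkowski_commute)

lemma Nminus_frame_derivatives:
  assumes "Nminus_frame I q h a k1 k2" "s \<in> I"
  shows "(q has_vector_derivative k1 s *\<^sub>R h s) (at s)"
    and "(h has_vector_derivative k1 s *\<^sub>R q s + k2 s *\<^sub>R a s) (at s)"
    and "(a has_vector_derivative - k2 s *\<^sub>R h s) (at s)"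
  using smooth_curve_on_has_vector_derivative[of I q s]
    smooth_curve_on_has_vector_derivative[of I h s]
    smooth_curve_on_has_vector_derivative[of I a s] assms
  by (auto simp: Nminus_frame_def)

text \<open>In the spacelike plane of \<open>h\<close> and \<open>a\<close> the frame turns at rate
  \<open>k2\<close> and the ruling turns relative to it at rate \<open>deriv \<beta> s\<close>, so
  the two rates enter only through their sum. The \<open>q\<close>-component is what
  \<open>h\<close> alone contributes, since the derivative of \<open>a\<close> has none.\<close>

lemma vderiv_transversal_ruling:
  assumes F: "Nminus_frame I q h a k1 k2" and s: "s \<in> I" and "smooth_curve_on I \<beta>"
  shows "vderiv (transversal_ruling \<beta> h a) s =
    (k1 s * cos (\<beta> s)) *\<^sub>R q s - ((deriv \<beta> s + k2 s) * sin (\<beta> s)) *\<^sub>R h s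
      + ((deriv \<beta> s + k2 s) * cos (\<beta> s)) *\<^sub>R a s"
proof -
  note [derivative_intros] = smooth_curve_on_has_real_derivative[OF assms(3) s]
  have "((\<lambda>s. cos (\<beta> s)) has_real_derivative - sin (\<beta> s) * deriv \<beta> s) (at s)"
    "((\<lambda>s. sin (\<beta> s)) has_real_derivative cos (\<beta> s) * deriv \<beta> s) (at s)"
    by (auto intro!: derivative_eq_intros)
  then have "(transversal_ruling \<beta> h a has_vector_derivative
      (cos (\<beta> s) *\<^sub>R (k1 s *\<^sub>R q s + k2 s *\<^sub>R a s) + (- sin (\<beta> s) * deriv \<beta> s) *\<^sub>R h s) +
      (sin (\<beta> s) *\<^sub>R (- k2 s *\<^sub>R h s) + (cos (\<beta> s) * deriv \<beta> s) *\<^sub>R a s)) (at s)"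
    unfolding transversal_ruling_def
    by (intro has_vector_derivative_add has_vector_derivative_scaleR
        Nminus_frame_derivatives[OF F s])
  then show ?thesis
    by (simp add: vector_derivative_at algebra_simps)
qed

text \<open>Coincidence means that the tangent of \<open>c\<close> is orthogonal to the derivative
  of the transversal ruling. The tangent has no \<open>h\<close>-component, so only the
  \<open>q\<close> and \<open>a\<close> terms of that derivative count, and both carry the factor
  \<open>cos (\<beta> s)\<close>.\<close>

lemma striction_coincide_iff:
  assumes F: "Nminus_frame I q h a k1 k2" and s: "s \<in> I"
    and c': "vderiv c s = cosh \<phi> *\<^sub>R q s + sinh \<phi> *\<^sub>R a s"
    and T: "transversal_surface I \<beta> h a"
  shows "striction_curve c (transversal_ruling \<beta> h a) s = c s \<longleftrightarrow>
    k1 s = tanh \<phi> * (deriv \<beta> s + k2 s)"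
proof -
  let ?r = "transversal_ruling \<beta> h a"
  note orth = Nminus_frame_orthonormal[OF F s]
  have \<beta>: "smooth_curve_on I \<beta>" and ne: "minkowski (vderiv ?r s) (vderiv ?r s) \<noteq> 0"
    and \<beta>ne: "\<And>n::int. \<beta> s \<noteq> (2 * of_int n + 1) * pi / 2"
    using T s by (auto simp: transversal_surface_def)
  \<comment> \<open>The odd multiples of \<open>pi / 2\<close> excluded for \<open>\<beta>\<close>
    are exactly the zeros of the cosine.\<close>
  have cos: "cos (\<beta> s) \<noteq> 0"
  proof
    assume "cos (\<beta> s) = 0"
    then obtain n :: int where "odd n" "\<beta> s = of_int n * (pi / 2)"
      by (auto simp: cos_zero_iff_int)
    moreover from \<open>odd n\<close> obtain m where "n = 2 * m + 1" by (rule oddE)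
    ultimately show False using \<beta>ne[of m] by simp
  qed
  \<comment> \<open>The ruling has Minkowski square 1, hence is nonzero, and a displacement along it
    vanishes only if the striction parameter does.\<close>
  have "minkowski (?r s) (?r s) = (cos (\<beta> s))\<^sup>2 + (sin (\<beta> s))\<^sup>2"
    by (simp add: transversal_ruling_def minkowski_bilinear orth power2_eq_square)
  then have "?r s \<noteq> 0" by (auto simp: minkowski_zero_left)
  then have "striction_curve c ?r s = c s \<longleftrightarrow> minkowski (vderiv c s) (vderiv ?r s) = 0"
    using ne by (simp add: striction_curve_def ruled_surface_def striction_param_def)
  also have "minkowski (vderiv c s) (vderiv ?r s) =
      cos (\<beta> s) * (sinh \<phi> * (deriv \<beta> s + k2 s) - cosh \<phi> * k1 s)"
    unfolding c' vderiv_transversal_ruling[OF F s \<beta>] minkowski_bilinear minkowski_diff_right orth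
    by (simp add: algebra_simps)
  also have "\<dots> = 0 \<longleftrightarrow> sinh \<phi> * (deriv \<beta> s + k2 s) = cosh \<phi> * k1 s"
    using cos by simp
  also have "\<dots> \<longleftrightarrow> k1 s = tanh \<phi> * (deriv \<beta> s + k2 s)"
    using cosh_real_pos[of \<phi>] by (auto simp: tanh_def field_simps)
  finally show ?thesis .
qed

text \<open>The derivatives of \<open>q\<close> and \<open>a\<close> are both multiples of
  \<open>h\<close>, so everything orthogonal to \<open>h\<close> comes from differentiating the
  hyperbolic coefficients and carries the factor \<open>deriv \<theta> s\<close>.\<close>

lemma vderiv2_striction_line:
  assumes F: "Nminus_frame I q h a k1 k2" and I: "open I" and s: "s \<in> I"
    and \<theta>: "smooth_curve_on I \<theta>"
    and c': "\<And>s. s \<in> I \<Longrightarrow> vderiv c s = cosh (\<theta> s) *\<^sub>R q s + sinh (\<theta> s) *\<^sub>R a s"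
  shows "vderiv (vderiv c) s =
    deriv \<theta> s *\<^sub>R (sinh (\<theta> s) *\<^sub>R q s + cosh (\<theta> s) *\<^sub>R a s)
      + (cosh (\<theta> s) * k1 s - sinh (\<theta> s) * k2 s) *\<^sub>R h s"
proof -
  note [derivative_intros] = smooth_curve_on_has_real_derivative[OF \<theta> s]
  have "((\<lambda>s. cosh (\<theta> s)) has_real_derivative sinh (\<theta> s) * deriv \<theta> s) (at s)"
    "((\<lambda>s. sinh (\<theta> s)) has_real_derivative cosh (\<theta> s) * deriv \<theta> s) (at s)"
    by (auto intro!: derivative_eq_intros)
  then have "((\<lambda>s. cosh (\<theta> s) *\<^sub>R q s + sinh (\<theta> s) *\<^sub>R a s) has_vector_derivative
      (cosh (\<theta> s) *\<^sub>R (k1 s *\<^sub>R h s) + (sinh (\<theta> s) * deriv \<theta> s) *\<^sub>R q s) +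
      (sinh (\<theta> s) *\<^sub>R (- k2 s *\<^sub>R h s) + (cosh (\<theta> s) * deriv \<theta> s) *\<^sub>R a s)) (at s)"
    by (intro has_vector_derivative_add has_vector_derivative_scaleR
        Nminus_frame_derivatives[OF F s])
  \<comment> \<open>The formula for \<open>vderiv c\<close> is known on \<open>I\<close> only;
    openness of \<open>I\<close> makes it valid near \<open>s\<close>, so that it may be
    differentiated.\<close>
  then have "(vderiv c has_vector_derivative
      (cosh (\<theta> s) *\<^sub>R (k1 s *\<^sub>R h s) + (sinh (\<theta> s) * deriv \<theta> s) *\<^sub>R q s) +
      (sinh (\<theta> s) *\<^sub>R (- k2 s *\<^sub>R h s) + (cosh (\<theta> s) * deriv \<theta> s) *\<^sub>R a s)) (at s)"
    by (rule has_vector_derivative_transform_within_open[OF _ I s]) (simp add: c')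
  then show ?thesis
    by (simp add: vector_derivative_at algebra_simps)
qed

lemma lin_dep_pair_frame_iff:
  assumes F: "Nminus_frame I q h a k1 k2" and s: "s \<in> I"
  shows "lin_dep_pair (h s) (d *\<^sub>R (sinh \<phi> *\<^sub>R q s + cosh \<phi> *\<^sub>R a s) + \<kappa> *\<^sub>R h s) \<longleftrightarrow> d = 0"
    (is "lin_dep_pair _ ?x \<longleftrightarrow> _")
proof
  note orth = Nminus_frame_orthonormal[OF F s]
  assume "lin_dep_pair (h s) ?x"
  then obtain u w where uw: "u \<noteq> 0 \<or> w \<noteq> 0" and z: "u *\<^sub>R h s + w *\<^sub>R ?x = 0"
    by (auto simp: lin_dep_pair_def)
  \<comment> \<open>Pairing with \<open>h\<close> shows that \<open>w = 0\<close> would force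
    \<open>u = 0\<close>, so \<open>w\<close> is nonzero; pairing with \<open>a\<close> then leaves
    \<open>d * cosh \<phi> = 0\<close>, and cosh is positive.\<close>
  have "minkowski (u *\<^sub>R h s + w *\<^sub>R ?x) (a s) = w * (d * cosh \<phi>)"
    "minkowski (u *\<^sub>R h s + w *\<^sub>R ?x) (h s) = u + w * \<kappa>"
    by (simp_all add: minkowski_bilinear orth)
  then have "w * (d * cosh \<phi>) = 0" "u + w * \<kappa> = 0"
    unfolding z by (simp_all add: minkowski_zero_left)
  then show "d = 0" using uw cosh_real_pos[of \<phi>] by auto
next
  assume "d = 0"
  then have "(- \<kappa>) *\<^sub>R h s + 1 *\<^sub>R ?x = 0" by simp
  then show "lin_dep_pair (h s) ?x"
    unfolding lin_dep_pair_def by (metis zero_neq_one)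
qed

text \<open>A vanishing derivative yields a single constant because an interval is convex. The
  converse uses openness: near each point of \<open>I\<close> the function agrees with a
  constant.\<close>

lemma deriv_zero_iff_constant_on:
  fixes f :: "real \<Rightarrow> real"
  assumes I: "open I" "is_interval I" and f: "smooth_curve_on I f"
  shows "(\<forall>s\<in>I. deriv f s = 0) \<longleftrightarrow> f constant_on I"
proof
  assume "\<forall>s\<in>I. deriv f s = 0"
  then have "(f has_real_derivative 0) (at s within I)" if "s \<in> I" for s
    using smooth_curve_on_has_real_derivative[OF f that] that
    by (metis has_field_derivative_at_within)
  then show "f constant_on I"
    using has_field_derivative_zero_constant[of I f] I(2)
    by (auto simp: constant_on_def is_interval_convex)
next
  assume "f constant_on I"
  then obtain y where y: "\<And>s. s \<in> I \<Longrightarrow> f s = y" by (auto simp: constant_on_def)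
  show "\<forall>s\<in>I. deriv f s = 0"
  proof
    fix s assume s: "s \<in> I"
    have "(f has_real_derivative 0) (at s)"
      by (rule has_field_derivative_transform_within_open[OF DERIV_const[of y] I(1) s])
        (simp add: y)
    then show "deriv f s = 0" by (rule DERIV_imp_deriv)
  qed
qed

theorem theorem5p3:
  fixes I :: "real set"
    and c q h a :: "real \<Rightarrow> real ^ 3"
    and k1 k2 \<theta> \<beta> :: "real \<Rightarrow> real"
  assumes I: "open I" "is_interval I" "I \<noteq> {}"
    and N: "timelike_ruled_surface_Nminus I c q h a k1 k2 \<theta>"
    and Nb: "transversal_surface I \<beta> h a"
    and coincide: "\<forall>s\<in>I. striction_curve c (transversal_ruling \<beta> h a) s = c s"
  shows "geodesic_on_ruled_surface I c h \<longleftrightarrow>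
         (\<exists>y::real. \<forall>s\<in>I. k1 s = y * (deriv \<beta> s + k2 s))"
proof -
  have F: "Nminus_frame I q h a k1 k2" and \<theta>: "smooth_curve_on I \<theta>"
    and c': "\<And>s. s \<in> I \<Longrightarrow> vderiv c s = cosh (\<theta> s) *\<^sub>R q s + sinh (\<theta> s) *\<^sub>R a s"
    and ncyl: "non_cylindrical_on I q"
    using N by (auto simp: timelike_ruled_surface_Nminus_def)
  have k1: "k1 s = tanh (\<theta> s) * (deriv \<beta> s + k2 s)" if "s \<in> I" for s
    using striction_coincide_iff[where c = c, OF F that c'[OF that] Nb] coincide that by blast
  \<comment> \<open>The derivative of \<open>q\<close> is \<open>k1 s *\<^sub>R h s\<close>, which
    is nonzero on a non-cylindrical surface.\<close>
  have k1_nz: "k1 s \<noteq> 0" if "s \<in> I" for s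
    using F ncyl that by (auto simp: Nminus_frame_def non_cylindrical_on_def)
  have "geodesic_on_ruled_surface I c h \<longleftrightarrow> (\<forall>s\<in>I. deriv \<theta> s = 0)"
    unfolding geodesic_on_ruled_surface_def
    using vderiv2_striction_line[where c = c, OF F I(1) _ \<theta> c'] lin_dep_pair_frame_iff[OF F]
    by simp
  also have "\<dots> \<longleftrightarrow> \<theta> constant_on I"
    by (rule deriv_zero_iff_constant_on[OF I(1,2) \<theta>])
  also have "\<dots> \<longleftrightarrow> (\<exists>y. \<forall>s\<in>I. k1 s = y * (deriv \<beta> s + k2 s))"
  proof
    assume "\<theta> constant_on I"
    then show "\<exists>y. \<forall>s\<in>I. k1 s = y * (deriv \<beta> s + k2 s)"
      using k1 by (metis constant_on_def)
  next
    assume "\<exists>y. \<forall>s\<in>I. k1 s = y * (deriv \<beta> s + k2 s)"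
    then obtain y where y: "\<And>s. s \<in> I \<Longrightarrow> k1 s = y * (deriv \<beta> s + k2 s)" by blast
    have "\<theta> s = artanh y" if "s \<in> I" for s
    proof -
      \<comment> \<open>As \<open>k1 s\<close> is nonzero, so is the common factor
        \<open>deriv \<beta> s + k2 s\<close> of its two expressions, and it cancels. Injectivity of
        tanh then fixes \<open>\<theta> s\<close>.\<close>
      have "tanh (\<theta> s) = y"
        using k1[OF that] y[OF that] k1_nz[OF that] by (metis mult_cancel_right mult_zero_right)
      then show ?thesis by (metis artanh_tanh_real)
    qed
    then show "\<theta> constant_on I" by (auto simp: constant_on_def)
  qed
  finally show ?thesis .
qed

end
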